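(* Let $g_k\in\mathbb{R}^n\setminus\{0\}$, let $B_k\in\mathbb{R}^{n\times n}$ be symmetric and such that the linear system $B_ks=-g_k$ has a solution, let $M_k\in\mathbb{R}^{n\times n}$ be symmetric positive definite, let $\sigma_k>0$, and let $m_k^Q$, $m_k$ be the quadratic and cubic models defined in the context. Assume that $m_k^Q$ admits a stationary point $s_k^Q$ (computed either exactly or over a subspace $\mathcal{L}_k$, as described in the context) which is not orthogonal to $g_k$ and satisfies $|g_k^\top s_k^Q|\ge\epsilon_d\|g_k\|\,\|s_k^Q\|$, where $\epsilon_d>0$ is a pre-defined constant. Let $s_k^{N}$ be the Newton-like step defined in the context. Then the step $s_k^{N}$ is a stationary point for the subproblem $\min_{s\in\mathbb{R}^n}m_k(s)$ if and only if there exists $\theta_k>0$ such that $$M_ks_k^Q=\frac{\theta_k}{g_k^\top s_k^Q}\,g_k .$$ Note that $\theta_k=\|s_k^Q\|_{M_k}^2$.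
   Context: Norms: $\|\cdot\|$ is the Euclidean norm and, for a symmetric positive definite $M_k$, $\|x\|_{M_k}=\sqrt{x^\top M_kx}$. Here $f:\mathbb{R}^n\to\mathbb{R}$ is continuously differentiable, $x_k\in\mathbb{R}^n$ is the current iterate and $g_k=\nabla f(x_k)\neq0$. Models: $m_k^Q(s)=f(x_k)+s^\top g_k+\tfrac12s^\top B_ks$ and $m_k(s)=m_k^Q(s)+\tfrac13\sigma_k\|s\|_{M_k}^3$. The step $s_k^Q$: in the exact case, $B_ks_k^Q=-g_k$. When a subspace method is used, $\mathcal{L}_k\subseteq\mathbb{R}^n$ is a linear subspace of dimension $l$, $Q_k\in\mathbb{R}^{n\times l}$ has columns forming a basis of $\mathcal{L}_k$, and $s_k^Q=Q_kz_k^Q$ is the exact stationary point of $m_k^Q$ over $\mathcal{L}_k$ (when it exists), i.e. $z_k^Q$ is a stationary point of $z\mapsto m_k^Q(Q_kz)$. Newton-like step: in the exact case, $s_k^{N}=\delta_k^{N}s_k^Q$ with $\delta_k^{N}=\arg\min_{\delta\in\mathcal{I}_k}m_k(\delta s_k^Q)$, where $\mathcal{I}_k=\mathbb{R}_+$ if $g_k^\top s_k^Q<0$ and $\mathcal{I}_k=\mathbb{R}_-$ otherwise. In the subspace case, $s_k^{N}=Q_kz_k^{N}$, where $z_k^{N}$ is the Newton-like step, defined in the same way with $z_k^Q$ in place of $s_k^Q$, associated with the reduced subproblem $$\min_{z\in\mathbb{R}^l}\ f(x_k)+z^\top Q_k^\top g_k+\tfrac12z^\top Q_k^\top B_kQ_kz+\tfrac13\sigma_k\|z\|^3_{Q_k^\top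 M_kQ_k}.$$
   Formalization: For a step computed over a subspace the equivalence on R^n is false unless s_k^Q is stationary for m_k^Q on all of R^n, so this is assumed there; for general subspace steps the equivalence and the value of θ_k are stated for the reduced subproblem instead. *)

theory Defs
  imports "HOL-Analysis.Analysis"
begin

definition stationary_point :: "('a::real_inner \<Rightarrow> real) \<Rightarrow> 'a \<Rightarrow> bool" where
  "stationary_point h x \<longleftrightarrow> GDERIV h x :> 0"

definition C1_with_gradient :: "('a::real_inner \<Rightarrow> real) \<Rightarrow> ('a \<Rightarrow> 'a) \<Rightarrow> bool" where
  "C1_with_gradient f grad \<longleftrightarrow> (\<forall>x. GDERIV f x :> grad x) \<and> continuous_on UNIV grad"

definition symmetric_mat :: "real ^ 'n ^ 'n \<Rightarrow> bool" where
  "symmetric_mat A \<longleftrightarrow> transpose A = A"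

definition spd_mat :: "real ^ 'n ^ 'n \<Rightarrow> bool" where
  "spd_mat A \<longleftrightarrow> symmetric_mat A \<and> (\<forall>x. x \<noteq> 0 \<longrightarrow> x \<bullet> (A *v x) > 0)"

definition mat_norm :: "real ^ 'n ^ 'n \<Rightarrow> real ^ 'n \<Rightarrow> real" where
  "mat_norm M x = sqrt (x \<bullet> (M *v x))"

definition quad_model :: "real \<Rightarrow> real ^ 'n \<Rightarrow> real ^ 'n ^ 'n \<Rightarrow> real ^ 'n \<Rightarrow> real" where
  "quad_model c g B s = c + s \<bullet> g + 1/2 * (s \<bullet> (B *v s))"

definition cubic_model ::
  "real \<Rightarrow> real ^ 'n \<Rightarrow> real ^ 'n ^ 'n \<Rightarrow> real ^ 'n ^ 'n \<Rightarrow> real \<Rightarrow> real ^ 'n \<Rightarrow> real" where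
  "cubic_model c g B M \<sigma> s = quad_model c g B s + 1/3 * \<sigma> * (mat_norm M s) ^ 3"

definition delta_range :: "real ^ 'n \<Rightarrow> real ^ 'n \<Rightarrow> real set" where
  "delta_range g sQ = (if g \<bullet> sQ < 0 then {0..} else {..0})"

(* arg_min_on is a choice operator; when s^T B s = - g^T s (as for every quadratic step below),
   g^T s \<noteq> 0, \<sigma> > 0 and M is positive definite, the minimiser exists and is unique. *)
definition newton_like_step ::
  "real \<Rightarrow> real ^ 'n \<Rightarrow> real ^ 'n ^ 'n \<Rightarrow> real ^ 'n ^ 'n \<Rightarrow> real \<Rightarrow> real ^ 'n \<Rightarrow> real ^ 'n" where
  "newton_like_step c g B M \<sigma> sQ =
     arg_min_on (\<lambda>\<delta>. cubic_model c g B M \<sigma> (\<delta> *\<^sub>R sQ)) (delta_range g sQ) *\<^sub>R sQ"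

definition columns_basis_of :: "real ^ 'l ^ 'n \<Rightarrow> (real ^ 'n) set \<Rightarrow> bool" where
  "columns_basis_of Q L \<longleftrightarrow>
     inj (\<lambda>i. column i Q) \<and> independent (columns Q) \<and> span (columns Q) = L"

definition reduced_vec :: "real ^ 'l ^ 'n \<Rightarrow> real ^ 'n \<Rightarrow> real ^ 'l" where
  "reduced_vec Q g = transpose Q *v g"

definition reduced_mat :: "real ^ 'l ^ 'n \<Rightarrow> real ^ 'n ^ 'n \<Rightarrow> real ^ 'l ^ 'l" where
  "reduced_mat Q A = transpose Q ** A ** Q"

definition exact_step ::
  "real \<Rightarrow> real ^ 'n \<Rightarrow> real ^ 'n ^ 'n \<Rightarrow> real ^ 'n ^ 'n \<Rightarrow> real \<Rightarrow> real ^ 'n \<Rightarrow> real ^ 'n \<Rightarrow> bool" where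
  "exact_step c g B M \<sigma> sQ sN \<longleftrightarrow>
     B *v sQ = - g \<and> sN = newton_like_step c g B M \<sigma> sQ"

definition subspace_step ::
  "real \<Rightarrow> real ^ 'n \<Rightarrow> real ^ 'n ^ 'n \<Rightarrow> real ^ 'n ^ 'n \<Rightarrow> real \<Rightarrow>
   (real ^ 'n) set \<Rightarrow> real ^ 'l ^ 'n \<Rightarrow> real ^ 'l \<Rightarrow> real ^ 'l \<Rightarrow>
   real ^ 'n \<Rightarrow> real ^ 'n \<Rightarrow> bool" where
  "subspace_step c g B M \<sigma> L Q zQ zN sQ sN \<longleftrightarrow>
     subspace L \<and> dim L = CARD('l) \<and> columns_basis_of Q L \<and>
     stationary_point (\<lambda>z. quad_model c g B (Q *v z)) zQ \<and> sQ = Q *v zQ \<and>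
     zN = newton_like_step c (reduced_vec Q g) (reduced_mat Q B) (reduced_mat Q M) \<sigma> zQ \<and>
     sN = Q *v zN"

end

theory Submission
  imports Defs
begin

text \<open>Along the line spanned by \<open>sQ\<close> the cubic model is a one-variable function; on the half-line
  of descent it is a cubic polynomial in \<open>\<bar>\<delta>\<bar>\<close> with positive leading coefficient and negative slope
  at 0, so its minimiser \<open>\<delta>\<close> is nonzero and is a critical point. With \<open>B sQ = - g\<close> and
  \<open>n = mat_norm M sQ\<close> this reads \<open>(1 - \<delta>) (g \<bullet> sQ) + \<sigma> \<bar>\<delta>\<bar> \<delta> n\<^sup>3 = 0\<close>. The gradient of
  the cubic model at \<open>\<delta> sQ\<close> is \<open>(1 - \<delta>) g + \<sigma> \<bar>\<delta>\<bar> \<delta> n (M sQ)\<close>; eliminating \<open>1 - \<delta>\<close>, it vanishes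
  exactly when \<open>M sQ = (n\<^sup>2 / (g \<bullet> sQ)) g\<close>. A subspace step is an exact step of the reduced
  problem, and is the same multiple of \<open>sQ\<close> as in the full space.\<close>

section \<open>Quadratic forms and the norm of a positive definite matrix\<close>

lemma symmetric_mat_inner:
  assumes "symmetric_mat A"
  shows "x \<bullet> (A *v y) = y \<bullet> (A *v x)"
proof -
  have "x v* A = A *v x"
    using assms by (metis symmetric_mat_def transpose_matrix_vector)
  then show ?thesis
    by (metis dot_lmul_matrix inner_commute)
qed

lemma spd_mat_nonneg:
  assumes "spd_mat M"
  shows "0 \<le> x \<bullet> (M *v x)"
  using assms by (cases "x = 0") (auto simp: spd_mat_def intro: less_imp_le)

lemma mat_norm_power2:
  assumes "spd_mat M"
  shows "(mat_norm M x)\<^sup>2 = x \<bullet> (M *v x)"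
  using spd_mat_nonneg[OF assms, of x] by (simp add: mat_norm_def)

lemma mat_norm_pos:
  assumes "spd_mat M" "x \<noteq> 0"
  shows "0 < mat_norm M x"
  using assms by (auto simp: mat_norm_def spd_mat_def)

lemma mat_norm_scaleR: "mat_norm M (d *\<^sub>R x) = \<bar>d\<bar> * mat_norm M x"
proof -
  have "(d *\<^sub>R x) \<bullet> (M *v (d *\<^sub>R x)) = d\<^sup>2 * (x \<bullet> (M *v x))"
    by (simp add: matrix_vector_mult_scaleR power2_eq_square)
  then show ?thesis
    by (simp add: mat_norm_def real_sqrt_mult)
qed

section \<open>Gradients of the quadratic and cubic models\<close>

lemma has_derivative_quadratic_form:
  assumes "symmetric_mat A"
  shows "((\<lambda>s. s \<bullet> (A *v s)) has_derivative (\<lambda>h. 2 * (h \<bullet> (A *v s)))) (at s)"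
proof -
  have "((\<lambda>s. s \<bullet> (A *v s)) has_derivative (\<lambda>h. s \<bullet> (A *v h) + h \<bullet> (A *v s))) (at s)"
    by (intro has_derivative_inner has_derivative_ident
        bounded_linear.has_derivative[OF matrix_vector_mul_bounded_linear])
  then show ?thesis
    using symmetric_mat_inner[OF assms] by simp
qed

lemma GDERIV_quad_model:
  assumes "symmetric_mat B"
  shows "GDERIV (quad_model c g B) s :> g + B *v s"
proof -
  have "((\<lambda>s. c + s \<bullet> g) has_derivative (\<lambda>h. h \<bullet> g)) (at s)"
    by (auto intro!: derivative_eq_intros)
  from has_derivative_add[OF this
      has_derivative_mult_right[OF has_derivative_quadratic_form[OF assms], of "1/2"]]
  show ?thesis
    unfolding gderiv_def quad_model_def[abs_def] by (simp add: inner_add_right)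
qed

text \<open>For \<open>s \<noteq> 0\<close> the argument of the square root is positive, so the
  chain rule applies; the factor \<open>1 / mat_norm M s\<close> it produces is absorbed by the
  cube.\<close>

lemma GDERIV_cubic_model:
  assumes "symmetric_mat B" "spd_mat M" "s \<noteq> 0"
  shows "GDERIV (cubic_model c g B M \<sigma>) s :> g + B *v s + (\<sigma> * mat_norm M s) *\<^sub>R (M *v s)"
proof -
  have pos: "0 < s \<bullet> (M *v s)" and sym: "symmetric_mat M"
    using assms by (auto simp: spd_mat_def)
  have N: "(mat_norm M has_derivative (\<lambda>h. (h \<bullet> (M *v s)) / mat_norm M s)) (at s)"
    unfolding mat_norm_def[abs_def]
    by (rule has_derivative_eq_rhs,
        rule has_derivative_real_sqrt[OF pos has_derivative_quadratic_form[OF sym]])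
      (simp add: fun_eq_iff field_simps)
  have "((\<lambda>s. mat_norm M s ^ 3) has_derivative
      (\<lambda>h. 3 * mat_norm M s * (h \<bullet> (M *v s)))) (at s)"
    by (rule has_derivative_eq_rhs, rule has_derivative_power[OF N])
      (use mat_norm_pos[OF assms(2,3)] in \<open>simp add: fun_eq_iff power2_eq_square\<close>)
  from has_derivative_add[OF GDERIV_quad_model[OF assms(1), unfolded gderiv_def]
      has_derivative_mult_right[OF this, of "1/3 * \<sigma>"]]
  show ?thesis
    unfolding gderiv_def cubic_model_def[abs_def]
    by (rule has_derivative_eq_rhs) (simp add: fun_eq_iff inner_add_right)
qed

text \<open>Derivatives are unique, and a gradient is recovered from its derivative by evaluating in
  the direction \<open>D\<close> itself.\<close>

lemma stationary_point_iff:
  assumes "GDERIV h x :> D"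
  shows "stationary_point h x \<longleftrightarrow> D = 0"
proof
  assume "stationary_point h x"
  then have "(\<lambda>y. y \<bullet> D) = (\<lambda>y. y \<bullet> 0)"
    using assms unfolding stationary_point_def gderiv_def by (metis has_derivative_unique)
  then have "D \<bullet> D = D \<bullet> 0"
    by meson
  then show "D = 0"
    by simp
next
  assume "D = 0"
  then show "stationary_point h x"
    using assms by (simp add: stationary_point_def)
qed

section \<open>Minimising a real cubic polynomial on the half-line\<close>

lemma cubic_half_line_minimiser_exists:
  fixes p b \<kappa> :: real
  assumes "\<kappa> > 0"
  shows "\<exists>t\<ge>0. \<forall>u\<ge>0. p * t + b / 2 * t\<^sup>2 + \<kappa> / 3 * t ^ 3 \<le> p * u + b / 2 * u\<^sup>2 + \<kappa> / 3 * u ^ 3"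
proof -
  define \<psi> where "\<psi> = (\<lambda>t. p * t + b / 2 * t\<^sup>2 + \<kappa> / 3 * t ^ 3)"
  \<comment> \<open>Beyond \<open>R\<close> the factor \<open>\<kappa> / 3 * u\<close> exceeds
    \<open>\<bar>p\<bar> + \<bar>b\<bar>\<close>, and the summand 1 ensures
    \<open>u \<le> u\<^sup>2\<close>. The cubic term then dominates, so
    \<open>\<psi> u \<ge> 0 = \<psi> 0\<close>, and a minimiser on the compact interval
    \<open>{0..R}\<close> is global.\<close>
  define R where "R = 1 + 3 * (\<bar>p\<bar> + \<bar>b\<bar>) / \<kappa>"
  have R: "R \<ge> 1"
    using assms by (simp add: R_def)
  have "continuous_on {0..R} \<psi>"
    unfolding \<psi>_def by (intro continuous_intros)
  then obtain t where t: "t \<in> {0..R}" and t_min: "\<And>u. u \<in> {0..R} \<Longrightarrow> \<psi> t \<le> \<psi> u"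
    using continuous_attains_inf[of "{0..R}" \<psi>] R by auto
  have "\<psi> t \<le> \<psi> u" if "u \<ge> 0" for u
  proof (cases "u \<le> R")
    case True
    then show ?thesis using t_min that by simp
  next
    case False
    have "u \<ge> 1" using False R by linarith
    have "\<bar>p\<bar> + \<bar>b\<bar> \<le> \<kappa> / 3 * u"
      using False assms by (simp add: R_def field_simps)
    then have "(\<bar>p\<bar> + \<bar>b\<bar>) * u\<^sup>2 \<le> \<kappa> / 3 * u * u\<^sup>2"
      by (rule mult_right_mono) simp
    moreover have "\<bar>p\<bar> * u \<le> \<bar>p\<bar> * u\<^sup>2"
      using \<open>u \<ge> 1\<close> by (intro mult_left_mono) (auto simp: power2_eq_square)
    moreover have "- (\<bar>p\<bar> * u) \<le> p * u" "- (\<bar>b\<bar> * u\<^sup>2) \<le> b * u\<^sup>2"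
      using \<open>u \<ge> 0\<close> mult_right_mono[of "- \<bar>p\<bar>" p u] mult_right_mono[of "- \<bar>b\<bar>" b "u\<^sup>2"] by auto
    moreover have "0 \<le> \<bar>b\<bar> * u\<^sup>2"
      by simp
    ultimately have "0 \<le> \<psi> u"
      unfolding \<psi>_def by (simp add: algebra_simps power3_eq_cube power2_eq_square)
    moreover have "\<psi> t \<le> \<psi> 0"
      using t_min R by simp
    ultimately show ?thesis
      by (simp add: \<psi>_def)
  qed
  then show ?thesis
    using t unfolding \<psi>_def by auto
qed

text \<open>The slope \<open>p < 0\<close> at 0 makes the polynomial decrease to the right of 0,
  which excludes \<open>t = 0\<close>; at an interior minimiser the derivative vanishes.\<close>

lemma cubic_half_line_minimiser_critical:
  fixes p b \<kappa> t :: real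
  assumes "p < 0" "t \<ge> 0"
    and min: "\<And>u. u \<ge> 0 \<Longrightarrow>
      p * t + b / 2 * t\<^sup>2 + \<kappa> / 3 * t ^ 3 \<le> p * u + b / 2 * u\<^sup>2 + \<kappa> / 3 * u ^ 3"
  shows "t > 0" "p + b * t + \<kappa> * t\<^sup>2 = 0"
proof -
  define \<psi> where "\<psi> = (\<lambda>t. p * t + b / 2 * t\<^sup>2 + \<kappa> / 3 * t ^ 3)"
  have D: "(\<psi> has_real_derivative p + b * t + \<kappa> * t\<^sup>2) (at t)" for t
    unfolding \<psi>_def by (auto intro!: derivative_eq_intros simp: power2_eq_square)
  have min': "\<psi> t \<le> \<psi> u" if "u \<ge> 0" for u
    using min[OF that] by (simp add: \<psi>_def)
  have "t \<noteq> 0"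
  proof
    assume "t = 0"
    moreover have "(\<psi> has_real_derivative p) (at 0)"
      using D[of 0] by simp
    then obtain e where "e > 0" "\<And>h. 0 < h \<Longrightarrow> h < e \<Longrightarrow> \<psi> (0 + h) < \<psi> 0"
      using DERIV_neg_dec_right \<open>p < 0\<close> by metis
    then have "\<psi> (e / 2) < \<psi> 0"
      by (metis add_0 field_sum_of_halves half_gt_zero less_add_same_cancel1)
    ultimately show False
      using min'[of "e / 2"] \<open>e > 0\<close> by simp
  qed
  then show "t > 0"
    using \<open>t \<ge> 0\<close> by simp
  \<comment> \<open>The ball of radius \<open>t\<close> around \<open>t\<close> stays inside the
    half-line, so the minimum is local in the two-sided sense.\<close>
  have "\<forall>u. \<bar>t - u\<bar> < t \<longrightarrow> \<psi> t \<le> \<psi> u"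
    using min' by auto
  then show "p + b * t + \<kappa> * t\<^sup>2 = 0"
    using DERIV_local_min[OF D \<open>t > 0\<close>] by blast
qed

section \<open>The Newton-like step as a critical point along its line\<close>

lemma cubic_model_scaleR:
  "cubic_model c g B M \<sigma> (\<delta> *\<^sub>R s) =
    c + \<delta> * (g \<bullet> s) + (s \<bullet> (B *v s)) / 2 * \<delta>\<^sup>2 + \<sigma> * mat_norm M s ^ 3 / 3 * \<bar>\<delta>\<bar> ^ 3"
  by (simp add: cubic_model_def quad_model_def mat_norm_scaleR matrix_vector_mult_scaleR
      inner_commute power2_eq_square power_mult_distrib mult_ac)

text \<open>The range is the half-line of descent, so on it the model depends on
  \<open>\<delta>\<close> only through \<open>\<bar>\<delta>\<bar>\<close>, whatever the sign of
  \<open>g \<bullet> s\<close>.\<close>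

lemma delta_range_inner:
  assumes "\<delta> \<in> delta_range g s"
  shows "\<delta> * (g \<bullet> s) = - \<bar>g \<bullet> s\<bar> * \<bar>\<delta>\<bar>"
  using assms by (auto simp: delta_range_def split: if_splits)

text \<open>Since \<open>arg_min_on\<close> is a choice, existence of a minimiser comes first; the
  equation is then derived for whichever one is chosen. The last term arises because
  \<open>\<bar>\<delta>\<bar> * \<delta>\<close> is the derivative of
  \<open>\<bar>\<delta>\<bar> ^ 3 / 3\<close>.\<close>

lemma newton_like_step_critical:
  assumes M: "spd_mat M" and "\<sigma> > 0" and a: "g \<bullet> s \<noteq> 0"
  obtains \<delta> where "newton_like_step c g B M \<sigma> s = \<delta> *\<^sub>R s" "\<delta> \<noteq> 0"
    "g \<bullet> s + (s \<bullet> (B *v s)) * \<delta> + \<sigma> * mat_norm M s ^ 3 * (\<bar>\<delta>\<bar> * \<delta>) = 0"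
proof -
  define \<phi> where "\<phi> = (\<lambda>\<delta>. cubic_model c g B M \<sigma> (\<delta> *\<^sub>R s))"
  define I where "I = delta_range g s"
  define b where "b = s \<bullet> (B *v s)"
  define \<kappa> where "\<kappa> = \<sigma> * mat_norm M s ^ 3"
  define p where "p = - \<bar>g \<bullet> s\<bar>"
  define \<psi> where "\<psi> = (\<lambda>t. p * t + b / 2 * t\<^sup>2 + \<kappa> / 3 * t ^ 3)"
  have \<phi>: "\<phi> \<delta> = c + \<psi> \<bar>\<delta>\<bar>" if "\<delta> \<in> I" for \<delta>
    using delta_range_inner[of \<delta> g s] that
    by (simp add: \<phi>_def \<psi>_def I_def b_def \<kappa>_def p_def cubic_model_scaleR)
  \<comment> \<open>Minimising \<open>\<phi>\<close> over \<open>I\<close> thus amounts to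
    minimising \<open>\<psi>\<close> over all nonnegative reals.\<close>
  have signed: "\<exists>\<delta>\<in>I. \<bar>\<delta>\<bar> = u" if "u \<ge> 0" for u
    using that by (intro bexI[of _ "if g \<bullet> s < 0 then u else - u"])
      (auto simp: I_def delta_range_def)
  have "s \<noteq> 0"
    using a by auto
  then have "\<kappa> > 0"
    using mat_norm_pos[OF M] \<open>\<sigma> > 0\<close> by (simp add: \<kappa>_def)
  then obtain t where t: "t \<ge> 0" "\<And>u. u \<ge> 0 \<Longrightarrow> \<psi> t \<le> \<psi> u"
    using cubic_half_line_minimiser_exists[of \<kappa> p b] unfolding \<psi>_def by auto
  obtain \<delta>' where \<delta>': "\<delta>' \<in> I" "\<bar>\<delta>'\<bar> = t"
    using signed[OF t(1)] by auto
  have "is_arg_min \<phi> (\<lambda>\<delta>. \<delta> \<in> I) \<delta>'"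
    using \<delta>' t(2) \<phi> by (auto simp: is_arg_min_linorder)
  define \<delta> where "\<delta> = arg_min_on \<phi> I"
  have "is_arg_min \<phi> (\<lambda>\<delta>. \<delta> \<in> I) \<delta>"
    unfolding \<delta>_def arg_min_on_def arg_min_def
    by (rule someI[of "is_arg_min \<phi> (\<lambda>\<delta>. \<delta> \<in> I)"]) fact
  then have \<delta>: "\<delta> \<in> I" and \<delta>_min: "\<And>d. d \<in> I \<Longrightarrow> \<phi> \<delta> \<le> \<phi> d"
    by (auto simp: is_arg_min_linorder)
  have "\<psi> \<bar>\<delta>\<bar> \<le> \<psi> u" if u: "u \<ge> 0" for u
  proof -
    obtain d where "d \<in> I" "\<bar>d\<bar> = u"
      using signed[OF u] by auto
    then show ?thesis
      using \<delta>_min \<phi> \<delta> by fastforce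
  qed
  moreover have "p < 0"
    using a by (simp add: p_def)
  ultimately have pos: "\<bar>\<delta>\<bar> > 0" and crit: "p + b * \<bar>\<delta>\<bar> + \<kappa> * \<bar>\<delta>\<bar>\<^sup>2 = 0"
    using cubic_half_line_minimiser_critical[of p "\<bar>\<delta>\<bar>" b \<kappa>] unfolding \<psi>_def by auto
  \<comment> \<open>On \<open>I\<close> the signs of \<open>\<delta>\<close> and
    \<open>g \<bullet> s\<close> are opposite. Hence \<open>\<delta>\<close> times the equation in
    \<open>\<bar>\<delta>\<bar>\<close> equals the nonzero \<open>\<bar>\<delta>\<bar>\<close> times
    the equation in \<open>\<delta>\<close>.\<close>
  have "(g \<bullet> s) * \<bar>\<delta>\<bar> = p * \<delta>"
    using \<delta> by (auto simp: p_def I_def delta_range_def split: if_splits)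
  then have "\<bar>\<delta>\<bar> * (g \<bullet> s + b * \<delta> + \<kappa> * (\<bar>\<delta>\<bar> * \<delta>)) = \<delta> * (p + b * \<bar>\<delta>\<bar> + \<kappa> * \<bar>\<delta>\<bar>\<^sup>2)"
    by (simp add: algebra_simps power2_eq_square)
  then have "g \<bullet> s + b * \<delta> + \<kappa> * (\<bar>\<delta>\<bar> * \<delta>) = 0"
    using pos crit by simp
  moreover have "newton_like_step c g B M \<sigma> s = \<delta> *\<^sub>R s"
    by (simp add: newton_like_step_def \<delta>_def \<phi>_def I_def)
  ultimately show thesis
    using that[of \<delta>] pos unfolding b_def \<kappa>_def by simp
qed

text \<open>Pairing the vector equation with \<open>s\<close> cancels \<open>g \<bullet> s\<close>
  and leaves \<open>s \<bullet> (M *v s) = \<theta>\<close>.\<close>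

lemma multiplier_eq_mat_norm:
  assumes "spd_mat M" "g \<bullet> s \<noteq> 0" "M *v s = (\<theta> / (g \<bullet> s)) *\<^sub>R g"
  shows "\<theta> = (mat_norm M s)\<^sup>2"
  using assms by (simp add: mat_norm_power2 inner_commute)

lemma newton_like_step_stationary_iff:
  assumes B: "symmetric_mat B" and M: "spd_mat M" and "\<sigma> > 0"
    and s: "B *v s = - g" and a: "g \<bullet> s \<noteq> 0"
  shows "stationary_point (cubic_model c g B M \<sigma>) (newton_like_step c g B M \<sigma> s) \<longleftrightarrow>
    (\<exists>\<theta>>0. M *v s = (\<theta> / (g \<bullet> s)) *\<^sub>R g)"
proof -
  define n where "n = mat_norm M s"
  obtain \<delta> where step: "newton_like_step c g B M \<sigma> s = \<delta> *\<^sub>R s" and "\<delta> \<noteq> 0"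
    and crit: "g \<bullet> s + (s \<bullet> (B *v s)) * \<delta> + \<sigma> * n ^ 3 * (\<bar>\<delta>\<bar> * \<delta>) = 0"
    using newton_like_step_critical[OF M \<open>\<sigma> > 0\<close> a] unfolding n_def by metis
  have "s \<noteq> 0"
    using a by auto
  then have "n > 0"
    using mat_norm_pos[OF M] by (simp add: n_def)
  \<comment> \<open>The coefficient of \<open>M *v s\<close> in the gradient at the step. The
    critical equation makes the coefficient of \<open>g\<close> a multiple of \<open>r\<close>, so
    the nonzero \<open>r\<close> factors out of the whole gradient.\<close>
  define r where "r = \<sigma> * n * (\<bar>\<delta>\<bar> * \<delta>)"
  have "r \<noteq> 0"
    using \<open>\<sigma> > 0\<close> \<open>n > 0\<close> \<open>\<delta> \<noteq> 0\<close> by (simp add: r_def)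
  have "(1 - \<delta>) * (g \<bullet> s) = - r * n\<^sup>2"
    using crit s by (simp add: r_def algebra_simps power2_eq_square power3_eq_cube inner_commute)
  then have \<delta>: "1 - \<delta> = - r * (n\<^sup>2 / (g \<bullet> s))"
    using a by (simp add: field_simps)
  have "g + B *v (\<delta> *\<^sub>R s) + (\<sigma> * mat_norm M (\<delta> *\<^sub>R s)) *\<^sub>R (M *v (\<delta> *\<^sub>R s)) =
      (1 - \<delta>) *\<^sub>R g + r *\<^sub>R (M *v s)"
    by (simp add: matrix_vector_mult_scaleR s mat_norm_scaleR r_def n_def algebra_simps)
  also have "\<dots> = r *\<^sub>R (M *v s - (n\<^sup>2 / (g \<bullet> s)) *\<^sub>R g)"
    unfolding \<delta> by (simp add: algebra_simps)
  finally have "stationary_point (cubic_model c g B M \<sigma>) (\<delta> *\<^sub>R s) \<longleftrightarrow>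
      M *v s = (n\<^sup>2 / (g \<bullet> s)) *\<^sub>R g"
    using stationary_point_iff[OF GDERIV_cubic_model[OF B M]] \<open>\<delta> \<noteq> 0\<close> \<open>s \<noteq> 0\<close> \<open>r \<noteq> 0\<close> by simp
  \<comment> \<open>Any admissible multiplier is forced to be \<open>n\<^sup>2\<close>, which is
    positive.\<close>
  also have "\<dots> \<longleftrightarrow> (\<exists>\<theta>>0. M *v s = (\<theta> / (g \<bullet> s)) *\<^sub>R g)"
    using multiplier_eq_mat_norm[OF M a] \<open>n > 0\<close> unfolding n_def by (metis zero_less_power)
  finally show ?thesis
    by (simp add: step)
qed

section \<open>Transfer between the reduced problem and the full space\<close>

lemma inner_reduced_vec: "z \<bullet> reduced_vec Q g = (Q *v z) \<bullet> g"
proof -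
  have "(z v* transpose Q) \<bullet> g = z \<bullet> (transpose Q *v g)"
    by (rule dot_lmul_matrix)
  then show ?thesis
    by (simp add: reduced_vec_def)
qed

lemma reduced_mat_mult: "reduced_mat Q A *v z = reduced_vec Q (A *v (Q *v z))"
  by (simp add: reduced_mat_def reduced_vec_def matrix_vector_mul_assoc matrix_mul_assoc)

lemma symmetric_reduced_mat:
  assumes "symmetric_mat A"
  shows "symmetric_mat (reduced_mat Q A)"
  using assms by (simp add: symmetric_mat_def reduced_mat_def matrix_transpose_mul matrix_mul_assoc)

lemma mat_norm_reduced: "mat_norm (reduced_mat Q M) z = mat_norm M (Q *v z)"
  by (simp add: mat_norm_def reduced_mat_mult inner_reduced_vec)

lemma quad_model_reduced:
  "quad_model c (reduced_vec Q g) (reduced_mat Q B) z = quad_model c g B (Q *v z)"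
  by (simp add: quad_model_def reduced_mat_mult inner_reduced_vec)

text \<open>Both steps minimise the same function of \<open>\<delta>\<close> over the same
  half-line, so \<open>arg_min_on\<close> returns the same scalar in both.\<close>

lemma newton_like_step_reduced:
  "Q *v newton_like_step c (reduced_vec Q g) (reduced_mat Q B) (reduced_mat Q M) \<sigma> z =
    newton_like_step c g B M \<sigma> (Q *v z)"
proof -
  have "delta_range (reduced_vec Q g) z = delta_range g (Q *v z)"
    using inner_reduced_vec[of z Q g] by (simp add: delta_range_def inner_commute)
  then show ?thesis
    by (simp add: newton_like_step_def cubic_model_def quad_model_reduced mat_norm_reduced
        matrix_vector_mult_scaleR)
qed

text \<open>A kernel vector is a linear relation among the columns, and these are
  independent.\<close>

lemma columns_basis_of_kernel:
  assumes "columns_basis_of Q L" "Q *v z = 0"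
  shows "z = 0"
proof -
  have inj: "inj (\<lambda>i. column i Q)" and ind: "independent (columns Q)"
    using assms(1) by (auto simp: columns_basis_of_def)
  \<comment> \<open>Independence concerns the set \<open>columns Q\<close>, so coefficients are
    indexed by vectors; injectivity of the column map allows the reindexing.\<close>
  define u where "u = (\<lambda>v. z $ (inv (\<lambda>i. column i Q) v))"
  have cols: "columns Q = range (\<lambda>i. column i Q)"
    by (auto simp: columns_def)
  have "(\<Sum>v\<in>columns Q. u v *\<^sub>R v) = (\<Sum>i\<in>UNIV. z $ i *\<^sub>R column i Q)"
    unfolding cols sum.reindex[OF inj] by (simp add: u_def inv_f_f[OF inj])
  also have "\<dots> = 0"
    using assms(2) by (simp add: matrix_mult_sum scalar_mult_eq_scaleR)
  finally have "\<forall>v\<in>columns Q. u v = 0"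
    using ind cols independentD[of "columns Q" "columns Q" u] by auto
  then have "u (column i Q) = 0" for i
    by (simp add: cols)
  then have "z $ i = 0" for i
    using inv_f_f[OF inj, of i] by (metis u_def)
  then show ?thesis
    by (simp add: vec_eq_iff)
qed

text \<open>The reduced form at \<open>z\<close> is the form of \<open>M\<close> at
  \<open>Q *v z\<close>, which is nonzero for \<open>z \<noteq> 0\<close> because the kernel is
  trivial.\<close>

lemma spd_reduced_mat:
  assumes "spd_mat M" "columns_basis_of Q L"
  shows "spd_mat (reduced_mat Q M)"
  using assms symmetric_reduced_mat[of M Q] columns_basis_of_kernel[OF assms(2)]
  by (auto simp: spd_mat_def reduced_mat_mult inner_reduced_vec)

text \<open>A subspace step guarantees stationarity of \<open>sQ\<close> only over \<open>L\<close>.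
  The equivalence in the full space is therefore conditional on stationarity there, and the last
  conjunct gives its counterpart in reduced coordinates.\<close>

theorem theorem3p2:
  fixes f :: "real ^ 'n \<Rightarrow> real" and grad :: "real ^ 'n \<Rightarrow> real ^ 'n"
    and x g sQ sN :: "real ^ 'n" and B M :: "real ^ 'n ^ 'n"
    and \<sigma> \<epsilon> :: real
    and L :: "(real ^ 'n) set" and Q :: "real ^ 'l ^ 'n" and zQ zN :: "real ^ 'l"
  assumes f_C1: "C1_with_gradient f grad"
    and g_def: "g = grad x"
    and g_nz: "g \<noteq> 0"
    and B_sym: "symmetric_mat B"
    and solvable: "\<exists>s. B *v s = - g"
    and M_spd: "spd_mat M"
    and sigma_pos: "\<sigma> > 0"
    and step: "exact_step (f x) g B M \<sigma> sQ sN \<or> subspace_step (f x) g B M \<sigma> L Q zQ zN sQ sN"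
    and not_orth: "g \<bullet> sQ \<noteq> 0"
    and eps_pos: "\<epsilon> > 0"
    and angle: "\<bar>g \<bullet> sQ\<bar> \<ge> \<epsilon> * norm g * norm sQ"
  shows
    "(stationary_point (quad_model (f x) g B) sQ \<longrightarrow>
        (stationary_point (cubic_model (f x) g B M \<sigma>) sN \<longleftrightarrow>
          (\<exists>\<theta>>0. M *v sQ = (\<theta> / (g \<bullet> sQ)) *\<^sub>R g))) \<and>
     (\<forall>\<theta>>0. M *v sQ = (\<theta> / (g \<bullet> sQ)) *\<^sub>R g \<longrightarrow> \<theta> = (mat_norm M sQ)\<^sup>2) \<and>
     (subspace_step (f x) g B M \<sigma> L Q zQ zN sQ sN \<longrightarrow>
        (stationary_point
            (cubic_model (f x) (reduced_vec Q g) (reduced_mat Q B) (reduced_mat Q M) \<sigma>) zN \<longleftrightarrow>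
          (\<exists>\<theta>>0. reduced_mat Q M *v zQ
                  = (\<theta> / (reduced_vec Q g \<bullet> zQ)) *\<^sub>R reduced_vec Q g)) \<and>
        (\<forall>\<theta>>0. reduced_mat Q M *v zQ
                  = (\<theta> / (reduced_vec Q g \<bullet> zQ)) *\<^sub>R reduced_vec Q g
                 \<longrightarrow> \<theta> = (mat_norm (reduced_mat Q M) zQ)\<^sup>2))"
proof (intro conjI impI allI)
  have sN: "sN = newton_like_step (f x) g B M \<sigma> sQ"
    using step by (auto simp: exact_step_def subspace_step_def newton_like_step_reduced)
  assume "stationary_point (quad_model (f x) g B) sQ"
  then have "B *v sQ = - g"
    using stationary_point_iff[OF GDERIV_quad_model[OF B_sym]] by (metis add_eq_0_iff)
  then show "stationary_point (cubic_model (f x) g B M \<sigma>) sN \<longleftrightarrow>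
      (\<exists>\<theta>>0. M *v sQ = (\<theta> / (g \<bullet> sQ)) *\<^sub>R g)"
    unfolding sN by (intro newton_like_step_stationary_iff B_sym M_spd sigma_pos not_orth)
next
  fix \<theta> :: real
  assume "M *v sQ = (\<theta> / (g \<bullet> sQ)) *\<^sub>R g"
  then show "\<theta> = (mat_norm M sQ)\<^sup>2"
    by (rule multiplier_eq_mat_norm[OF M_spd not_orth])
next
  assume sub: "subspace_step (f x) g B M \<sigma> L Q zQ zN sQ sN"
  let ?g = "reduced_vec Q g" and ?B = "reduced_mat Q B" and ?M = "reduced_mat Q M"
  have zN: "zN = newton_like_step (f x) ?g ?B ?M \<sigma> zQ"
    and sQ: "sQ = Q *v zQ"
    and basis: "columns_basis_of Q L"
    and stat: "stationary_point (\<lambda>z. quad_model (f x) g B (Q *v z)) zQ"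
    using sub by (auto simp: subspace_step_def)
  have B': "symmetric_mat ?B"
    by (rule symmetric_reduced_mat[OF B_sym])
  have M': "spd_mat ?M"
    by (rule spd_reduced_mat[OF M_spd basis])
  \<comment> \<open>Stationarity over \<open>L\<close> is stationarity of the reduced quadratic, so
    \<open>zQ\<close> is an exact step of the reduced problem.\<close>
  have "stationary_point (quad_model (f x) ?g ?B) zQ"
    using stat by (simp add: quad_model_reduced[abs_def])
  then have zQ: "?B *v zQ = - ?g"
    using stationary_point_iff[OF GDERIV_quad_model[OF B']] by (metis add_eq_0_iff)
  have orth': "?g \<bullet> zQ \<noteq> 0"
    using not_orth inner_reduced_vec[of zQ Q g] sQ by (simp add: inner_commute)
  show "stationary_point (cubic_model (f x) ?g ?B ?M \<sigma>) zN \<longleftrightarrow>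
      (\<exists>\<theta>>0. ?M *v zQ = (\<theta> / (?g \<bullet> zQ)) *\<^sub>R ?g)"
    unfolding zN by (rule newton_like_step_stationary_iff[OF B' M' sigma_pos zQ orth'])
  show "\<theta> = (mat_norm ?M zQ)\<^sup>2" if "?M *v zQ = (\<theta> / (?g \<bullet> zQ)) *\<^sub>R ?g" for \<theta>
    by (rule multiplier_eq_mat_norm[OF M' orth' that])
qed

end
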